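(* Let $(\mathbf{E},d)$ and $(\widetilde{\mathbf{E}},\widetilde d)$ be metric spaces with open-ball $\sigma$-algebras $\mathcal{B}^\circ$ and $\widetilde{\mathcal{B}}^\circ$, respectively. For every $n\in\mathbb{N}$ let $\mathbf{E}_n\subseteq\mathbf{E}$ and let $\xi_n$ be an $(\mathbf{E},\mathcal{B}^\circ)$-valued random variable on some probability space $(\Omega_n,\mathcal{F}_n,\mathbb{P}_n)$ such that $\xi_n(\Omega_n)\subseteq\mathbf{E}_n$. Let $\xi_0$ be an $(\mathbf{E},\mathcal{B}^\circ)$-valued random variable on some probability space $(\Omega_0,\mathcal{F}_0,\mathbb{P}_0)$ such that $\xi_0(\Omega_0)\subseteq\mathbf{E}_0$ for some separable $\mathbf{E}_0\in\mathcal{B}^\circ$. For every $n\in\mathbb{N}$ let $h_n:\mathbf{E}_n\to\widetilde{\mathbf{E}}$ be a map such that $h_n(\xi_n):\Omega_n\to\widetilde{\mathbf{E}}$ is $(\mathcal{F}_n,\widetilde{\mathcal{B}}^\circ)$-measurable. Let $h_0:\mathbf{E}_0\to\widetilde{\mathbf{E}}$ be a $(\mathcal{B}_0^\circ,\widetilde{\mathcal{B}}^\circ)$-measurable map, where $\mathcal{B}_0^\circ:=\mathcal{B}^\circ\cap\mathbf{E}_0$ is the trace $\sigma$-algebra. Assume moreover: (a) $\xi_n\leadsto^\circ\xi_0$. (b) For every choice of $x_n\in\mathbf{E}_n$, $n\in\mathbb{N}_0$, we have $\widetilde d(h_n(x_n),h_0(x_0))\to0$ whenever $d(x_n,x_0)\to0$.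 Then $h_n(\xi_n)\leadsto^\circ h_0(\xi_0)$.
   Context: For a metric space $(\mathbf{E},d)$, the open-ball $\sigma$-algebra $\mathcal{B}^\circ$ is the $\sigma$-algebra generated by the open balls $\{y:d(x,y)<r\}$, $x\in\mathbf{E}$, $r>0$. For $(\mathbf{E},\mathcal{B}^\circ)$-valued random variables $X_n$, $n\in\mathbb{N}_0$ (possibly on different probability spaces), $X_n\leadsto^\circ X_0$ (convergence in distribution$^\circ$) means $\int g\,d\,\mathrm{law}\{X_n\}\to\int g\,d\,\mathrm{law}\{X_0\}$ for every bounded, continuous, $(\mathcal{B}^\circ,\mathcal{B}(\mathbb{R}))$-measurable function $g:\mathbf{E}\to\mathbb{R}$. *)

theory Defs
  imports "HOL-Probability.Probability"
begin

(* May be strictly coarser than borel when the space is not separable. *)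
definition ball_sigma :: "'a::metric_space measure" where
  "ball_sigma = sigma UNIV {ball x r | x r. 0 < r}"

(* Index 0 is the limit variable. Measurability is part of the notion, because
   distr need not be a probability law for a nonmeasurable map. The nth term of the
   sequence at n = 0 is irrelevant to the limit. *)
definition conv_distr_ball ::
    "(nat \<Rightarrow> 'w measure) \<Rightarrow> (nat \<Rightarrow> 'w \<Rightarrow> 'a::metric_space) \<Rightarrow> bool" where
  "conv_distr_ball M X \<longleftrightarrow>
     (\<forall>n. prob_space (M n) \<and> X n \<in> measurable (M n) ball_sigma) \<and>
     (\<forall>g :: 'a \<Rightarrow> real.
        bounded (range g) \<and> continuous_on UNIV g \<and> g \<in> measurable ball_sigma borel \<longrightarrow>
        (\<lambda>n. \<integral>x. g x \<partial>distr (M n) ball_sigma (X n))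
          \<longlonglongrightarrow> (\<integral>x. g x \<partial>distr (M 0) ball_sigma (X 0)))"

end

(* For a test function g put f_n = g o h_n. Applied to both g and -g, it is enough to bound
   liminf E f_n(xi_n) from below by E f_0(xi_0). The function
   F_k(x) = min(C, inf {f_n(y) + k d(x,y) | n >= k, y in E_n}) is k-Lipschitz and lies below
   f_n on E_n for n >= k. Since E_0 is separable, F_k can be replaced by a k-Lipschitz minorant
   G_k that is measurable for the open balls and equals F_k on E_0. Hence
   liminf_n E f_n(xi_n) >= lim_n E G_k(xi_n) = E G_k(xi_0) for every k. By hypothesis (b),
   liminf_k G_k >= f_0 on the part of E_0 all of whose points have only balls of positive
   law(xi_0)-measure; by separability this part has full measure, and dominated convergence
   finishes the proof. *)

theory Submission
  imports Defs
begin

section \<open>Measurability and Lipschitz functions for the open-ball sigma-algebra\<close>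

lemma space_ball_sigma [simp]: "space ball_sigma = UNIV"
  by (simp add: ball_sigma_def)

lemma ball_in_sets_ball_sigma [measurable]: "ball x r \<in> sets ball_sigma"
proof (cases "r > 0")
  case True
  then have "ball x r \<in> {ball x r |x r. 0 < r}" by blast
  then show ?thesis
    unfolding ball_sigma_def by simp
next
  case False
  then have "ball x r = {}" by auto
  then show ?thesis by (metis sets.empty_sets)
qed

text \<open>Sublevel sets of the distance to a fixed point are balls. All measurable test functions
  below are built from such distances, as continuity alone does not give measurability for
  \<open>ball_sigma\<close>.\<close>

lemma dist_measurable_ball_sigma [measurable]:
  "(\<lambda>x. dist x z) \<in> borel_measurable ball_sigma"
proof (rule borel_measurableI_less)
  fix a :: real
  have "{x \<in> space ball_sigma. dist x z < a} = ball z a"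
    by (auto simp: dist_commute)
  then show "{x \<in> space ball_sigma. dist x z < a} \<in> sets ball_sigma"
    by simp
qed

lemma continuous_on_if_lipschitz:
  fixes f :: "'a::metric_space \<Rightarrow> real"
  assumes "L \<ge> 0" and "\<And>x y. f x \<le> f y + L * dist x y"
  shows "continuous_on UNIV f"
proof -
  have "L-lipschitz_on UNIV f"
  proof (rule lipschitz_onI)
    fix x y
    show "dist (f x) (f y) \<le> L * dist x y"
      using assms(2)[of x y] assms(2)[of y x] by (auto simp: dist_real_def dist_commute)
  qed (fact assms(1))
  then show ?thesis by (rule lipschitz_on_continuous_on)
qed

text \<open>Taking the supremum over a countable set only is what makes the minorant measurable with
  respect to the open balls, even if \<open>F\<close> is not.\<close>

lemma lipschitz_minorant_ball_sigma:
  fixes F :: "'a::metric_space \<Rightarrow> real"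
  assumes D: "countable D" "D \<noteq> {}" and "L \<ge> 0"
    and lip: "\<And>x y. F x \<le> F y + L * dist x y"
    and bound: "\<And>x. \<bar>F x\<bar> \<le> C"
  obtains G where "\<And>x. \<bar>G x\<bar> \<le> C" "continuous_on UNIV G" "G \<in> borel_measurable ball_sigma"
    "\<And>x. G x \<le> F x" "\<And>x. x \<in> closure D \<Longrightarrow> G x = F x"
proof -
  \<comment> \<open>McShane's extension of \<open>F\<close> restricted to \<open>D\<close>: the
    smallest function with Lipschitz constant \<open>L\<close> that agrees with \<open>F\<close> on
    \<open>D\<close>.\<close>
  define H where "H x = (SUP z\<in>D. F z - L * dist x z)" for x
  \<comment> \<open>Far from \<open>D\<close> the function \<open>H\<close> may drop without bound.
    Cutting at \<open>- C\<close> restores boundedness and keeps \<open>G\<close> below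
    \<open>F\<close>, because \<open>F\<close> itself is at least \<open>- C\<close>.\<close>
  define G where "G x = max (- C) (H x)" for x
  have below: "F z - L * dist x z \<le> F x" for x z
    using lip[of z x] by (simp add: dist_commute)
  have bdd: "bdd_above ((\<lambda>z. F z - L * dist x z) ` D)" for x
    using below by (intro bdd_aboveI2)
  have HF: "H x \<le> F x" for x
    unfolding H_def using D(2) below by (intro cSUP_least)
  have HL: "H x \<le> H y + L * dist x y" for x y
    unfolding H_def[of x]
  proof (rule cSUP_least[OF D(2)])
    fix z assume "z \<in> D"
    then have "F z - L * dist y z \<le> H y"
      unfolding H_def by (intro cSUP_upper bdd)
    moreover have "L * dist y z \<le> L * dist x z + L * dist x y"
      using mult_left_mono[OF dist_triangle[of y z x] \<open>L \<ge> 0\<close>]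
      by (simp add: algebra_simps dist_commute)
    ultimately show "F z - L * dist x z \<le> H y + L * dist x y"
      by linarith
  qed
  have GF: "G x \<le> F x" for x
    using HF[of x] bound[of x] by (auto simp: G_def)
  have contH: "continuous_on UNIV H"
    using \<open>L \<ge> 0\<close> HL by (rule continuous_on_if_lipschitz)
  have contF: "continuous_on UNIV F"
    using \<open>L \<ge> 0\<close> lip by (rule continuous_on_if_lipschitz)
  have contG: "continuous_on UNIV G"
    unfolding G_def by (intro continuous_intros contH)
  have eqD: "G z = F z" if "z \<in> D" for z
  proof -
    have "F z - L * dist z z \<le> H z"
      unfolding H_def using that by (intro cSUP_upper bdd)
    then show ?thesis using HF[of z] bound[of z] by (auto simp: G_def)
  qed
  have "G x = F x" if "x \<in> closure D" for x
  proof -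
    have "closed {x. G x = F x}"
      by (rule closed_Collect_eq[OF contG contF])
    moreover have "D \<subseteq> {x. G x = F x}" using eqD by auto
    ultimately show ?thesis using that closure_minimal by blast
  qed
  moreover have "\<bar>G x\<bar> \<le> C" for x
    using GF[of x] bound[of x] by (auto simp: G_def)
  moreover have "G \<in> borel_measurable ball_sigma"
  proof -
    have "H \<in> borel_measurable ball_sigma"
      unfolding H_def using D(1) bdd by (intro borel_measurable_cSUP) auto
    then show ?thesis unfolding G_def by measurable
  qed
  ultimately show thesis using that contG GF by blast
qed

section \<open>Test functions, the support of the limit law, and balls of positive mass\<close>

lemma conv_distr_ball_integral_tendsto:
  fixes \<xi> :: "nat \<Rightarrow> 'w \<Rightarrow> 'a::metric_space" and g :: "'a \<Rightarrow> real"
  assumes conv: "conv_distr_ball M \<xi>"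
    and g: "\<And>x. \<bar>g x\<bar> \<le> C" "continuous_on UNIV g" "g \<in> borel_measurable ball_sigma"
  shows "(\<lambda>n. \<integral>\<omega>. g (\<xi> n \<omega>) \<partial>M n) \<longlonglongrightarrow> (\<integral>\<omega>. g (\<xi> 0 \<omega>) \<partial>M 0)"
proof -
  have "bounded (range g)"
    using g(1) by (auto simp: bounded_iff)
  then have "(\<lambda>n. \<integral>x. g x \<partial>distr (M n) ball_sigma (\<xi> n))
      \<longlonglongrightarrow> (\<integral>x. g x \<partial>distr (M 0) ball_sigma (\<xi> 0))"
    using conv g(2,3) by (simp add: conv_distr_ball_def)
  moreover have "(\<integral>x. g x \<partial>distr (M n) ball_sigma (\<xi> n)) = (\<integral>\<omega>. g (\<xi> n \<omega>) \<partial>M n)" for n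
    using conv g(3) by (intro integral_distr) (auto simp: conv_distr_ball_def)
  ultimately show ?thesis by simp
qed

text \<open>A value of \<open>X\<close> that is the centre of a null ball also lies in a smaller
  null ball with centre in \<open>D\<close> and radius \<open>inverse (Suc m)\<close>. There are
  countably many of these, so together they are avoided almost surely.\<close>

lemma AE_balls_not_null:
  fixes X :: "'w \<Rightarrow> 'a::metric_space"
  assumes X: "X \<in> measurable M ball_sigma"
    and D: "countable D" "\<And>\<omega>. \<omega> \<in> space M \<Longrightarrow> X \<omega> \<in> closure D"
  shows "AE \<omega> in M. \<forall>r>0. \<not> (AE \<omega>' in M. X \<omega>' \<notin> ball (X \<omega>) r)"
proof -
  define Q where "Q = {(z, m). z \<in> D \<and> (AE \<omega>' in M. X \<omega>' \<notin> ball z (inverse (Suc m)))}"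
  have "Q \<subseteq> D \<times> UNIV" by (auto simp: Q_def)
  then have "countable Q"
    by (rule countable_subset) (use D(1) in auto)
  then have "AE \<omega> in M. \<forall>q\<in>Q. X \<omega> \<notin> ball (fst q) (inverse (Suc (snd q)))"
    by (subst AE_ball_countable) (auto simp: Q_def)
  then show ?thesis
  proof (rule AE_mp, intro AE_I2 impI allI notI)
    fix \<omega> and r :: real
    assume \<omega>: "\<omega> \<in> space M" and avoid: "\<forall>q\<in>Q. X \<omega> \<notin> ball (fst q) (inverse (Suc (snd q)))"
      and "r > 0" and null: "AE \<omega>' in M. X \<omega>' \<notin> ball (X \<omega>) r"
    \<comment> \<open>With radius below \<open>r / 2\<close>, a ball around \<open>z\<close> that
      contains \<open>X \<omega>\<close> lies inside \<open>ball (X \<omega>) r\<close> and inherits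
      its nullity.\<close>
    obtain m where m: "inverse (real (Suc m)) < r / 2"
      using reals_Archimedean[of "r / 2"] \<open>r > 0\<close> by auto
    obtain z where z: "z \<in> D" "dist z (X \<omega>) < inverse (Suc m)"
      using D(2)[OF \<omega>] unfolding closure_approachable
      by (meson inverse_positive_iff_positive of_nat_0_less_iff zero_less_Suc)
    have "ball z (inverse (Suc m)) \<subseteq> ball (X \<omega>) r"
    proof
      fix y assume "y \<in> ball z (inverse (Suc m))"
      then show "y \<in> ball (X \<omega>) r"
        using z(2) m dist_triangle[of "X \<omega>" y z] by (simp add: dist_commute)
    qed
    then have "AE \<omega>' in M. X \<omega>' \<notin> ball z (inverse (Suc m))"
      by - (rule AE_mp[OF null], rule AE_I2, blast)
    then have "(z, m) \<in> Q" using z(1) by (simp add: Q_def)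
    then show False using avoid z(2) by force
  qed
qed

text \<open>A tent function supported on the ball has positive integral in the limit, hence
  eventually along the sequence, so it cannot vanish at all values of
  \<open>\<xi> n\<close>.\<close>

lemma conv_distr_ball_eventually_hits:
  fixes \<xi> :: "nat \<Rightarrow> 'w \<Rightarrow> 'a::metric_space"
  assumes conv: "conv_distr_ball M \<xi>" and "r > 0"
    and pos: "\<not> (AE \<omega> in M 0. \<xi> 0 \<omega> \<notin> ball x r)"
  shows "\<forall>\<^sub>F n in sequentially. \<exists>\<omega>\<in>space (M n). dist (\<xi> n \<omega>) x < r"
proof -
  \<comment> \<open>Continuous substitute for the indicator of \<open>ball x r\<close>; it is
    measurable for the open balls because it depends only on the distance to
    \<open>x\<close>.\<close>
  define g where "g y = max 0 (r - dist y x)" for y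
  have g: "\<bar>g y\<bar> \<le> r" for y using \<open>r > 0\<close> by (auto simp: g_def)
  have cont: "continuous_on UNIV g" unfolding g_def by (intro continuous_intros)
  have meas [measurable]: "g \<in> borel_measurable ball_sigma" unfolding g_def by measurable
  interpret prob_space "M 0" using conv by (simp add: conv_distr_ball_def)
  have [measurable]: "\<xi> 0 \<in> measurable (M 0) ball_sigma"
    using conv by (simp add: conv_distr_ball_def)
  have int: "integrable (M 0) (\<lambda>\<omega>. g (\<xi> 0 \<omega>))"
    using g by (intro integrable_const_bound[where B = r]) auto
  have nonneg: "0 \<le> g y" for y by (simp add: g_def)
  have "(\<integral>\<omega>. g (\<xi> 0 \<omega>) \<partial>M 0) \<noteq> 0"
  proof
    assume "(\<integral>\<omega>. g (\<xi> 0 \<omega>) \<partial>M 0) = 0"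
    then have "AE \<omega> in M 0. g (\<xi> 0 \<omega>) = 0"
      using integral_nonneg_eq_0_iff_AE[OF int] nonneg by auto
    then have "AE \<omega> in M 0. \<xi> 0 \<omega> \<notin> ball x r"
      by (rule AE_mp) (auto simp: g_def dist_commute max_def split: if_splits)
    with pos show False by simp
  qed
  moreover have "(\<integral>\<omega>. g (\<xi> 0 \<omega>) \<partial>M 0) \<ge> 0"
    using nonneg by (intro integral_nonneg_AE) auto
  ultimately have "(\<integral>\<omega>. g (\<xi> 0 \<omega>) \<partial>M 0) > 0" by simp
  then have "\<forall>\<^sub>F n in sequentially. (\<integral>\<omega>. g (\<xi> n \<omega>) \<partial>M n) > 0"
    using conv_distr_ball_integral_tendsto[OF conv g cont meas] by (rule order_tendstoD(1)[rotated])
  then show ?thesis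
  proof eventually_elim
    case (elim n)
    show ?case
    proof (rule ccontr)
      assume "\<not> ?thesis"
      then have "(\<integral>\<omega>. g (\<xi> n \<omega>) \<partial>M n) = (\<integral>\<omega>. 0 \<partial>M n)"
        by (intro Bochner_Integration.integral_cong) (auto simp: g_def max_def not_less)
      with elim show False by simp
    qed
  qed
qed

section \<open>From sequential convergence to a bound on a neighbourhood\<close>

text \<open>Hypothesis \<open>lim\<close> says nothing about subsequences \<open>x (r k) \<in> E (r k)\<close>; that \<open>x\<close> is
  a limit of points of the sets \<open>E n\<close> allows completing them to full sequences.\<close>

lemma locally_uniform_lower_bound:
  fixes E :: "nat \<Rightarrow> 'a::metric_space set" and f :: "nat \<Rightarrow> 'a \<Rightarrow> real"
  assumes x: "x \<in> E 0" and "e > 0"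
    and ne: "\<And>n. E n \<noteq> {}"
    and near: "\<And>r. r > 0 \<Longrightarrow> \<forall>\<^sub>F n in sequentially. \<exists>y\<in>E n. dist y x < r"
    and lim: "\<And>x. (\<And>n. x n \<in> E n) \<Longrightarrow> (\<lambda>n. dist (x n) (x 0)) \<longlonglongrightarrow> 0 \<Longrightarrow>
               (\<lambda>n. f n (x n)) \<longlonglongrightarrow> f 0 (x 0)"
  obtains \<delta> N where "\<delta> > 0" "\<And>n y. n \<ge> N \<Longrightarrow> y \<in> E n \<Longrightarrow> dist y x < \<delta> \<Longrightarrow> f n y > f 0 x - e"
proof (rule ccontr)
  note witness = that
  assume no: "\<not> thesis"
  have bad: "\<exists>n\<ge>N. \<exists>y\<in>E n. dist y x < \<delta> \<and> f n y \<le> f 0 x - e" if "\<delta> > 0" for \<delta> N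
  proof (rule ccontr)
    assume "\<not> ?thesis"
    then have thesis using \<open>\<delta> > 0\<close> by (intro witness[of \<delta> N]) (auto simp: not_le dest: leD)
    with no show False by simp
  qed
  \<comment> \<open>Index 0 is excluded because the full sequence built below must have the limit
    point \<open>x\<close> as its zeroth term.\<close>
  let ?P = "\<lambda>k n. n > 0 \<and> (\<exists>y\<in>E n. dist y x < inverse (Suc k) \<and> f n y \<le> f 0 x - e)"
  have hit: "\<exists>n>m. ?P k n" for k m
  proof -
    have "inverse (real (Suc k)) > 0" by simp
    from bad[OF this, of "Suc m"] show ?thesis
      by (auto simp: Suc_le_eq dest: order.strict_trans1[OF le0])
  qed
  have "\<exists>r. \<forall>k. ?P k (r k) \<and> r k < r (Suc k)"
  proof (rule dependent_nat_choice)
    show "\<exists>n. ?P 0 n" using hit[of 0 0] by blast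
    show "\<exists>n'. ?P (Suc k) n' \<and> n < n'" for n k
      using hit[of n "Suc k"] by blast
  qed
  then obtain r where r: "\<And>k. ?P k (r k)" and "\<And>k. r k < r (Suc k)" by blast
  then have mono: "strict_mono r" by (simp add: strict_mono_Suc_iff)
  obtain y where y: "\<And>k. y k \<in> E (r k)" "\<And>k. dist (y k) x < inverse (Suc k)"
      "\<And>k. f (r k) (y k) \<le> f 0 x - e"
    using r by metis
  \<comment> \<open>The distance to \<open>E n\<close> need not be attained, so an almost nearest
    point is taken. By \<open>near\<close> these points converge to \<open>x\<close>.\<close>
  have "\<exists>z\<in>E n. dist z x < infdist x (E n) + inverse (Suc n)" for n
  proof -
    have "(INF z\<in>E n. dist x z) < infdist x (E n) + inverse (Suc n)"
      using ne[of n] by (simp add: infdist_notempty)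
    then show ?thesis
      using cINF_less_iff[OF ne bdd_below_image_dist] by (metis dist_commute)
  qed
  then obtain w where w: "\<And>n. w n \<in> E n" "\<And>n. dist (w n) x < infdist x (E n) + inverse (Suc n)"
    by metis
  \<comment> \<open>The violating points fill the indices in the range of \<open>r\<close>, the
    almost nearest points fill the gaps, and the whole sequence becomes admissible for
    \<open>lim\<close>.\<close>
  define u where "u n = (if n = 0 then x else if n \<in> range r then y (inv r n) else w n)" for n
  have inj: "inj r" using mono by (rule strict_mono_imp_inj_on)
  have u0: "u 0 = x" by (simp add: u_def)
  have ur: "u (r k) = y k" for k using r[of k] inj by (simp add: u_def)
  have uE: "u n \<in> E n" for n
    using x w(1) y(1) inj by (auto simp: u_def)
  have "(\<lambda>n. dist (u n) (u 0)) \<longlonglongrightarrow> 0"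
  proof (rule order_tendstoI)
    fix a :: real assume "a < 0"
    then show "\<forall>\<^sub>F n in sequentially. a < dist (u n) (u 0)"
      by (intro always_eventually) (meson less_le_trans zero_le_dist)
  next
    fix a :: real assume "0 < a"
    obtain K where K: "inverse (real (Suc K)) < a / 2"
      using reals_Archimedean[of "a / 2"] \<open>a > 0\<close> by auto
    have small: "inverse (real (Suc k)) < a / 2" if "k \<ge> K" for k
      using K that by (smt (verit) le_imp_inverse_le of_nat_0_less_iff of_nat_le_iff zero_less_Suc Suc_le_mono)
    have "\<forall>\<^sub>F n in sequentially. \<exists>y\<in>E n. dist y x < a / 2"
      using \<open>a > 0\<close> by (intro near) simp
    \<comment> \<open>The bound by \<open>K\<close> makes the error of \<open>w n\<close> small; the
      bound by \<open>r K\<close> forces \<open>k \<ge> K\<close> whenever \<open>n = r k\<close>,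
      which makes \<open>y k\<close> close to \<open>x\<close>.\<close>
    moreover have "\<forall>\<^sub>F n in sequentially. n \<ge> r K \<and> n \<ge> K"
      by (intro eventually_conj eventually_ge_at_top)
    ultimately show "\<forall>\<^sub>F n in sequentially. dist (u n) (u 0) < a"
    proof eventually_elim
      case (elim n)
      then obtain y' where y': "y' \<in> E n" "dist y' x < a / 2" by blast
      have "dist (w n) x < a"
        using w(2)[of n] infdist_le[OF y'(1), of x] y'(2) small[of n] elim
        by (simp add: dist_commute)
      moreover have "dist (y k) x < a" if "n = r k" for k
      proof -
        have "k \<ge> K" using elim that mono by (simp add: strict_mono_less_eq)
        then show ?thesis using y(2)[of k] small[of k] \<open>a > 0\<close> by simp
      qed
      ultimately show ?case
        using \<open>a > 0\<close> inj unfolding u0 by (auto simp: u_def)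
    qed
  qed
  then have "(\<lambda>n. f n (u n)) \<longlonglongrightarrow> f 0 (u 0)" using uE by (intro lim)
  \<comment> \<open>Along \<open>r\<close> the values stay at most \<open>f 0 x - e\<close>, yet
    they must converge to \<open>f 0 x\<close>.\<close>
  then have "(\<lambda>k. f (r k) (u (r k))) \<longlonglongrightarrow> f 0 x"
    using LIMSEQ_subseq_LIMSEQ[OF _ mono] unfolding u0 by (fastforce simp: o_def)
  then have "f 0 x \<le> f 0 x - e"
    using y(3) by (intro LIMSEQ_le_const2) (auto simp: ur)
  with \<open>e > 0\<close> show False by simp
qed

section \<open>Lipschitz lower envelopes of the tails\<close>

text \<open>A Pasch-Hausdorff envelope (infimal convolution with a multiple of the distance), taken
  over a whole tail. The same \<open>k\<close> is tail index and slope, so one limit both discards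
  early functions and localizes at \<open>x\<close>. Inserting \<open>C\<close> caps the value and
  keeps the set nonempty for any \<open>E\<close>.\<close>

definition lower_envelope ::
    "real \<Rightarrow> (nat \<Rightarrow> 'a::metric_space set) \<Rightarrow> (nat \<Rightarrow> 'a \<Rightarrow> real) \<Rightarrow> nat \<Rightarrow> 'a \<Rightarrow> real" where
  "lower_envelope C E f k x =
     Inf (insert C {f n y + real k * dist x y | n y. n \<ge> k \<and> y \<in> E n})"

context
  fixes C :: real and E :: "nat \<Rightarrow> 'a::metric_space set" and f :: "nat \<Rightarrow> 'a \<Rightarrow> real"
  assumes bound: "\<And>n y. \<bar>f n y\<bar> \<le> C"
begin

lemma penalized_ge: "- C \<le> f n y + real k * dist x y"
proof -
  have "0 \<le> real k * dist x y" by simp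
  then show ?thesis using bound[of n y] by linarith
qed

lemma lower_envelope_bdd:
  "bdd_below (insert C {f n y + real k * dist x y | n y. n \<ge> k \<and> y \<in> E n})"
proof (rule bdd_belowI)
  fix v assume "v \<in> insert C {f n y + real k * dist x y | n y. n \<ge> k \<and> y \<in> E n}"
  then consider "v = C" | n y where "v = f n y + real k * dist x y" by blast
  then show "- C \<le> v"
    using bound[of 0 x] penalized_ge by cases auto
qed

lemma lower_envelope_le_const: "lower_envelope C E f k x \<le> C"
  unfolding lower_envelope_def by (rule cInf_lower[OF _ lower_envelope_bdd]) simp

lemma lower_envelope_le:
  "n \<ge> k \<Longrightarrow> y \<in> E n \<Longrightarrow> lower_envelope C E f k x \<le> f n y + real k * dist x y"
  unfolding lower_envelope_def by (rule cInf_lower[OF _ lower_envelope_bdd]) blast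

lemma lower_envelope_greatest:
  assumes "a \<le> C" "\<And>n y. n \<ge> k \<Longrightarrow> y \<in> E n \<Longrightarrow> a \<le> f n y + real k * dist x y"
  shows "a \<le> lower_envelope C E f k x"
  unfolding lower_envelope_def using assms by (intro cInf_greatest) auto

lemma abs_lower_envelope_le: "\<bar>lower_envelope C E f k x\<bar> \<le> C"
proof -
  have "- C \<le> lower_envelope C E f k x"
    using bound[of 0 x] penalized_ge by (intro lower_envelope_greatest) auto
  then show ?thesis using lower_envelope_le_const[of k x] by simp
qed

text \<open>The infimum is over functions of \<open>x\<close> that are constant or have Lipschitz
  constant \<open>k\<close>, and such a bound survives infima.\<close>

lemma lower_envelope_lipschitz:
  "lower_envelope C E f k x \<le> lower_envelope C E f k y + real k * dist x y"
proof -
  have "lower_envelope C E f k x - real k * dist x y \<le> lower_envelope C E f k y"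
  proof (rule lower_envelope_greatest)
    have "0 \<le> real k * dist x y" by simp
    then show "lower_envelope C E f k x - real k * dist x y \<le> C"
      using lower_envelope_le_const[of k x] by linarith
    fix n z assume "n \<ge> k" "z \<in> E n"
    then show "lower_envelope C E f k x - real k * dist x y \<le> f n z + real k * dist y z"
      using lower_envelope_le[of k n z x] mult_left_mono[OF dist_triangle[of x z y], of "real k"]
      by (simp add: algebra_simps)
  qed
  then show ?thesis by simp
qed

text \<open>Competitors \<open>y\<close> within \<open>\<delta>\<close> of \<open>x\<close> are
  controlled by the assumption; for the others the penalty, at least \<open>k * \<delta>\<close>,
  outweighs any deficit of \<open>f n y\<close>.\<close>

lemma eventually_lower_envelope_gt:
  assumes "\<delta> > 0" "e > 0" "\<And>n y. n \<ge> N \<Longrightarrow> y \<in> E n \<Longrightarrow> dist y x < \<delta> \<Longrightarrow> f n y > f 0 x - e"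
  shows "\<forall>\<^sub>F k in sequentially. lower_envelope C E f k x \<ge> f 0 x - e"
proof -
  \<comment> \<open>\<open>2 * C\<close> is the largest possible gap between \<open>f 0 x\<close>
    and \<open>f n y\<close>.\<close>
  obtain K :: nat where K: "real K * \<delta> > 2 * C"
    using reals_Archimedean3[OF \<open>\<delta> > 0\<close>] by blast
  show ?thesis
    using eventually_ge_at_top[of "max K N"]
  proof eventually_elim
    case (elim k)
    show ?case
    proof (rule lower_envelope_greatest)
      show "f 0 x - e \<le> C" using bound[of 0 x] \<open>e > 0\<close> by simp
      fix n y assume n: "n \<ge> k" "y \<in> E n"
      show "f 0 x - e \<le> f n y + real k * dist x y"
      proof (cases "dist y x < \<delta>")
        case True
        have "0 \<le> real k * dist x y" by simp
        moreover have "f n y > f 0 x - e" using True n elim by (intro assms(3)) auto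
        ultimately show ?thesis by linarith
      next
        case False
        have "real K * \<delta> \<le> real k * dist x y"
          using False elim \<open>\<delta> > 0\<close> by (intro mult_mono) (auto simp: dist_commute)
        then show ?thesis using K bound[of 0 x] bound[of n y] \<open>e > 0\<close> by linarith
      qed
    qed
  qed
qed

end

section \<open>The liminf inequality for the integrals\<close>

text \<open>Quantifying over \<open>a\<close> below the limit integral expresses the liminf bound.
  For one fixed \<open>k\<close>, \<open>a\<close> is below the integral of
  \<open>G k (\<xi> 0 \<omega>)\<close>, which is the limit of the integrals of
  \<open>G k (\<xi> n \<omega>)\<close>, and these are below those of
  \<open>f n (\<xi> n \<omega>)\<close> for \<open>n \<ge> k\<close>.\<close>

lemma eventually_integral_gt:
  fixes M :: "nat \<Rightarrow> 'w measure" and E :: "nat \<Rightarrow> 'a::metric_space set"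
    and \<xi> :: "nat \<Rightarrow> 'w \<Rightarrow> 'a" and f :: "nat \<Rightarrow> 'a \<Rightarrow> real"
  assumes conv: "conv_distr_ball M \<xi>"
    and \<xi>E: "\<And>n \<omega>. \<omega> \<in> space (M n) \<Longrightarrow> \<xi> n \<omega> \<in> E n"
    and D: "countable D" "E 0 \<subseteq> closure D"
    and bound: "\<And>n y. \<bar>f n y\<bar> \<le> C"
    and meas [measurable]: "\<And>n. (\<lambda>\<omega>. f n (\<xi> n \<omega>)) \<in> borel_measurable (M n)"
    and lim: "\<And>x. (\<And>n. x n \<in> E n) \<Longrightarrow> (\<lambda>n. dist (x n) (x 0)) \<longlonglongrightarrow> 0 \<Longrightarrow>
               (\<lambda>n. f n (x n)) \<longlonglongrightarrow> f 0 (x 0)"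
    and a: "a < (\<integral>\<omega>. f 0 (\<xi> 0 \<omega>) \<partial>M 0)"
  shows "\<forall>\<^sub>F n in sequentially. a < (\<integral>\<omega>. f n (\<xi> n \<omega>) \<partial>M n)"
proof -
  have prob: "prob_space (M n)" and [measurable]: "\<xi> n \<in> measurable (M n) ball_sigma" for n
    using conv by (auto simp: conv_distr_ball_def)
  have ne: "E n \<noteq> {}" for n
    using prob_space.not_empty[OF prob] \<xi>E by blast
  have "D \<noteq> {}" using ne D(2) by force
  let ?F = "lower_envelope C E f"
  have "\<exists>G. (\<forall>x. \<bar>G x\<bar> \<le> C) \<and> continuous_on UNIV G \<and> G \<in> borel_measurable ball_sigma \<and>
      (\<forall>x. G x \<le> ?F k x) \<and> (\<forall>x\<in>closure D. G x = ?F k x)" for k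
    by (rule lipschitz_minorant_ball_sigma[OF D(1) \<open>D \<noteq> {}\<close>, of "real k" "?F k" C])
      (auto intro: lower_envelope_lipschitz[OF bound] abs_lower_envelope_le[OF bound])
  then obtain G where G: "\<And>k x. \<bar>G k x\<bar> \<le> C" "\<And>k. continuous_on UNIV (G k)"
      and [measurable]: "\<And>k. G k \<in> borel_measurable ball_sigma"
      and GF: "\<And>k x. G k x \<le> ?F k x" "\<And>k x. x \<in> closure D \<Longrightarrow> G k x = ?F k x"
    by metis
  \<comment> \<open>The point \<open>y\<close> is its own competitor in the envelope, at zero
    penalty.\<close>
  have Gf: "G k y \<le> f n y" if "n \<ge> k" "y \<in> E n" for k n y
    using GF(1)[of k y] lower_envelope_le[of f C k n y E y, OF bound that] by simp
  have "AE \<omega> in M 0. \<forall>r>0. \<not> (AE \<omega>' in M 0. \<xi> 0 \<omega>' \<notin> ball (\<xi> 0 \<omega>) r)"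
    using D \<xi>E by (intro AE_balls_not_null) auto
  \<comment> \<open>Only a lower bound on the liminf of \<open>G k\<close> is available. Taking the
    minimum with \<open>f 0\<close> supplies the upper bound and turns it into convergence, as
    dominated convergence requires.\<close>
  then have AE: "AE \<omega> in M 0. (\<lambda>k. min (G k (\<xi> 0 \<omega>)) (f 0 (\<xi> 0 \<omega>))) \<longlonglongrightarrow> f 0 (\<xi> 0 \<omega>)"
  proof (rule AE_mp, intro AE_I2 impI)
    fix \<omega> assume \<omega>: "\<omega> \<in> space (M 0)"
      and supp: "\<forall>r>0. \<not> (AE \<omega>' in M 0. \<xi> 0 \<omega>' \<notin> ball (\<xi> 0 \<omega>) r)"
    let ?x = "\<xi> 0 \<omega>"
    have x: "?x \<in> E 0" using \<xi>E \<omega> by blast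
    have near: "\<forall>\<^sub>F n in sequentially. \<exists>y\<in>E n. dist y ?x < r" if "r > 0" for r
      using conv_distr_ball_eventually_hits[OF conv that, of ?x] supp that
      by (auto elim!: eventually_mono intro: \<xi>E)
    show "(\<lambda>k. min (G k ?x) (f 0 ?x)) \<longlonglongrightarrow> f 0 ?x"
    proof (rule order_tendstoI)
      fix b assume "b < f 0 ?x"
      \<comment> \<open>Half the gap, since the envelope bound is not strict and the conclusion must
        be.\<close>
      define e where "e = (f 0 ?x - b) / 2"
      have "e > 0" using \<open>b < f 0 ?x\<close> by (simp add: e_def)
      obtain \<delta> N where "\<delta> > 0" "\<And>n y. n \<ge> N \<Longrightarrow> y \<in> E n \<Longrightarrow> dist y ?x < \<delta> \<Longrightarrow> f n y > f 0 ?x - e"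
        using locally_uniform_lower_bound[where f = f, OF x \<open>e > 0\<close> ne near lim] by blast
      then have "\<forall>\<^sub>F k in sequentially. ?F k ?x \<ge> f 0 ?x - e"
        using \<open>e > 0\<close> by (intro eventually_lower_envelope_gt[OF bound])
      then show "\<forall>\<^sub>F k in sequentially. b < min (G k ?x) (f 0 ?x)"
        by eventually_elim (use GF(2) x D(2) \<open>b < f 0 ?x\<close> in \<open>auto simp: e_def field_simps\<close>)
    next
      fix b assume "f 0 ?x < b"
      then show "\<forall>\<^sub>F k in sequentially. min (G k ?x) (f 0 ?x) < b"
        by (intro always_eventually) auto
    qed
  qed
  interpret M0: prob_space "M 0" by (rule prob)
  have "(\<lambda>k. \<integral>\<omega>. min (G k (\<xi> 0 \<omega>)) (f 0 (\<xi> 0 \<omega>)) \<partial>M 0) \<longlonglongrightarrow> (\<integral>\<omega>. f 0 (\<xi> 0 \<omega>) \<partial>M 0)"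
  proof (rule integral_dominated_convergence[where w = "\<lambda>_. C"])
    show "AE \<omega> in M 0. norm (min (G k (\<xi> 0 \<omega>)) (f 0 (\<xi> 0 \<omega>))) \<le> C" for k
      using G(1)[of k] bound[of 0] by (intro AE_I2) (auto simp: min_def)
  qed (use AE in auto)
  then have "\<forall>\<^sub>F k in sequentially. a < (\<integral>\<omega>. min (G k (\<xi> 0 \<omega>)) (f 0 (\<xi> 0 \<omega>)) \<partial>M 0)"
    using a by (rule order_tendstoD(1))
  then obtain k where k: "a < (\<integral>\<omega>. min (G k (\<xi> 0 \<omega>)) (f 0 (\<xi> 0 \<omega>)) \<partial>M 0)"
    using eventually_happens by force
  have intG: "integrable (M n) (\<lambda>\<omega>. G k (\<xi> n \<omega>))" for n
  proof -
    interpret prob_space "M n" by (rule prob)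
    show ?thesis using G(1) by (intro integrable_const_bound[where B = C]) auto
  qed
  have intf: "integrable (M n) (\<lambda>\<omega>. f n (\<xi> n \<omega>))" for n
  proof -
    interpret prob_space "M n" by (rule prob)
    show ?thesis using bound by (intro integrable_const_bound[where B = C]) auto
  qed
  note k
  also have "(\<integral>\<omega>. min (G k (\<xi> 0 \<omega>)) (f 0 (\<xi> 0 \<omega>)) \<partial>M 0) \<le> (\<integral>\<omega>. G k (\<xi> 0 \<omega>) \<partial>M 0)"
    using intG intf by (intro integral_mono integrable_min) auto
  \<comment> \<open>With \<open>k\<close> now fixed, \<open>G k\<close> is an admissible test
    function for the convergence of \<open>\<xi>\<close>.\<close>
  finally have "\<forall>\<^sub>F n in sequentially. a < (\<integral>\<omega>. G k (\<xi> n \<omega>) \<partial>M n)"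
    using conv_distr_ball_integral_tendsto[OF conv G(1) G(2)] by (intro order_tendstoD(1)) auto
  then show ?thesis
    using eventually_ge_at_top[of k]
  proof eventually_elim
    case (elim n)
    have "(\<integral>\<omega>. G k (\<xi> n \<omega>) \<partial>M n) \<le> (\<integral>\<omega>. f n (\<xi> n \<omega>) \<partial>M n)"
      using elim intG intf Gf \<xi>E by (intro integral_mono) auto
    with elim show ?case by simp
  qed
qed

section \<open>The mapping theorem from the one-sided bound\<close>

lemma separable_space_top_of_setE:
  fixes S :: "'a::topological_space set"
  assumes "separable_space (top_of_set S)"
  obtains D where "countable D" "S \<subseteq> closure D"
proof -
  obtain D where "countable D" "D \<subseteq> S" "top_of_set S closure_of D = S"
    using assms unfolding separable_space_def by auto
  then have "S \<subseteq> closure D"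
    using closure_mono[of "S \<inter> D" D] by (auto simp: closure_of_subtopology)
  with \<open>countable D\<close> show thesis by (rule that)
qed

theorem theoremC1:
  fixes M :: "nat \<Rightarrow> 'w measure"
    and E :: "nat \<Rightarrow> 'a::metric_space set"
    and \<xi> :: "nat \<Rightarrow> 'w \<Rightarrow> 'a"
    and h :: "nat \<Rightarrow> 'a \<Rightarrow> 'b::metric_space"
  assumes "\<And>n. prob_space (M n)"
    and "\<And>n. \<xi> n \<in> measurable (M n) ball_sigma"
    and "\<And>n. \<xi> n ` space (M n) \<subseteq> E n"
    and "separable_space (top_of_set (E 0))"
    and "E 0 \<in> sets ball_sigma"
    and "\<And>n. n \<ge> 1 \<Longrightarrow> (\<lambda>\<omega>. h n (\<xi> n \<omega>)) \<in> measurable (M n) ball_sigma"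
    and "h 0 \<in> measurable (restrict_space ball_sigma (E 0)) ball_sigma"
    and "conv_distr_ball M \<xi>"
    and "\<And>x. (\<And>n. x n \<in> E n) \<Longrightarrow> (\<lambda>n. dist (x n) (x 0)) \<longlonglongrightarrow> 0 \<Longrightarrow>
               (\<lambda>n. dist (h n (x n)) (h 0 (x 0))) \<longlonglongrightarrow> 0"
  shows "conv_distr_ball M (\<lambda>n \<omega>. h n (\<xi> n \<omega>))"
proof -
  note conv = assms(8)
  have \<xi>E: "\<xi> n \<omega> \<in> E n" if "\<omega> \<in> space (M n)" for n \<omega>
    using assms(3)[of n] that by blast
  obtain D where D: "countable D" "E 0 \<subseteq> closure D"
    using assms(4) by (rule separable_space_top_of_setE)
  \<comment> \<open>\<open>h 0\<close> is measurable only for the trace on \<open>E 0\<close>, so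
    \<open>\<xi> 0\<close> is first viewed as a map into that trace space.\<close>
  have "\<xi> 0 \<in> measurable (M 0) (restrict_space ball_sigma (E 0))"
    using assms(2,3) by (intro measurable_restrict_space2) auto
  then have meas0: "(\<lambda>\<omega>. h 0 (\<xi> 0 \<omega>)) \<in> measurable (M 0) ball_sigma"
    using assms(7) by (rule measurable_compose)
  have meas: "(\<lambda>\<omega>. h n (\<xi> n \<omega>)) \<in> measurable (M n) ball_sigma" for n
    using meas0 assms(6)[of n] by (cases n) auto
  have "(\<lambda>n. \<integral>x. g x \<partial>distr (M n) ball_sigma (\<lambda>\<omega>. h n (\<xi> n \<omega>)))
      \<longlonglongrightarrow> (\<integral>x. g x \<partial>distr (M 0) ball_sigma (\<lambda>\<omega>. h 0 (\<xi> 0 \<omega>)))"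
    if "bounded (range g)" and cont: "continuous_on UNIV g"
      and g: "g \<in> borel_measurable ball_sigma"
    for g :: "'b \<Rightarrow> real"
  proof -
    obtain C where C: "\<And>y. \<bar>g y\<bar> \<le> C"
      using \<open>bounded (range g)\<close> by (auto simp: bounded_iff)
    have gmeas: "(\<lambda>\<omega>. g (h n (\<xi> n \<omega>))) \<in> borel_measurable (M n)" for n
      using meas g by (rule measurable_compose)
    have lim: "(\<lambda>n. g (h n (x n))) \<longlonglongrightarrow> g (h 0 (x 0))"
      if "\<And>n. x n \<in> E n" "(\<lambda>n. dist (x n) (x 0)) \<longlonglongrightarrow> 0" for x
    proof -
      have "(\<lambda>n. h n (x n)) \<longlonglongrightarrow> h 0 (x 0)"
        using assms(9)[OF that] by (subst tendsto_dist_iff)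
      then show ?thesis
        using cont by (auto intro: continuous_on_tendsto_compose)
    qed
    have "(\<lambda>n. \<integral>\<omega>. g (h n (\<xi> n \<omega>)) \<partial>M n) \<longlonglongrightarrow> (\<integral>\<omega>. g (h 0 (\<xi> 0 \<omega>)) \<partial>M 0)"
    proof (rule order_tendstoI)
      fix a assume a: "a < (\<integral>\<omega>. g (h 0 (\<xi> 0 \<omega>)) \<partial>M 0)"
      show "\<forall>\<^sub>F n in sequentially. a < (\<integral>\<omega>. g (h n (\<xi> n \<omega>)) \<partial>M n)"
        by (intro eventually_integral_gt[OF conv \<xi>E D, where f = "\<lambda>n y. g (h n y)" and C = C])
          (fact C gmeas lim a | assumption)+
    next
      fix a assume "(\<integral>\<omega>. g (h 0 (\<xi> 0 \<omega>)) \<partial>M 0) < a"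
      \<comment> \<open>The upper bound is the lower bound for \<open>- g\<close>, which satisfies
        the same bound \<open>C\<close> and the same sequential convergence.\<close>
      then have "- a < (\<integral>\<omega>. - g (h 0 (\<xi> 0 \<omega>)) \<partial>M 0)" by simp
      moreover have "(\<lambda>n. - g (h n (x n))) \<longlonglongrightarrow> - g (h 0 (x 0))"
        if "\<And>n. x n \<in> E n" "(\<lambda>n. dist (x n) (x 0)) \<longlonglongrightarrow> 0" for x
        using that by (intro tendsto_minus lim)
      ultimately have "\<forall>\<^sub>F n in sequentially. - a < (\<integral>\<omega>. - g (h n (\<xi> n \<omega>)) \<partial>M n)"
        using C gmeas
        by (intro eventually_integral_gt[OF conv \<xi>E D, where f = "\<lambda>n y. - g (h n y)" and C = C]) auto
      then show "\<forall>\<^sub>F n in sequentially. (\<integral>\<omega>. g (h n (\<xi> n \<omega>)) \<partial>M n) < a" by simp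
    qed
    moreover have "(\<integral>x. g x \<partial>distr (M n) ball_sigma (\<lambda>\<omega>. h n (\<xi> n \<omega>)))
        = (\<integral>\<omega>. g (h n (\<xi> n \<omega>)) \<partial>M n)" for n
      using meas g by (rule integral_distr)
    ultimately show ?thesis by simp
  qed
  then show ?thesis
    unfolding conv_distr_ball_def using assms(1) meas by simp
qed

end
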